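(* Let $s$ be any (finite) string over a linearly ordered alphabet, let $s=f_1^{e_1}\cdots f_m^{e_m}$ be its Lyndon factorization and let $s=p_1\cdots p_z$ be its non-overlapping LZ factorization. Then $m<2z$.
   Context: Strings are over a finite linearly ordered alphabet $\Sigma$. Lexicographic order: $u\preceq v$ if either $u$ is a prefix of $v$, or $u=xaw_1$, $v=xbw_2$ for strings $x,w_1,w_2$ and letters $a\prec b$. A Lyndon word is a nonempty string that is strictly lexicographically smaller than each of its nonempty proper suffixes. The Lyndon factorization of $s$ is the unique factorization $s=f_1^{e_1}\cdots f_m^{e_m}$ in which every $f_i$ is a Lyndon word, every $e_i\ge 1$, and $f_i\succ f_{i+1}$ for $1\le i<m$; its size is $m$. The non-overlapping LZ factorization $s=p_1\cdots p_z$ is built greedily from left to right: each phrase $p_i$ is either the leftmost occurrence in $s$ of a letter, or the longest prefix of $p_i\cdots p_z$ that occurs as a substring of $p_1\cdots p_{i-1}$; its size is $z$.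
   Formalization: The string s is assumed nonempty: for the empty string both factorizations have size 0, so m < 2z would read 0 < 0, which is false. *)

theory Defs
  imports Main "HOL-Library.Sublist" "HOL-Library.List_Lexorder"
begin

text \<open>
  The order on strings is the lexicographic order on lists from
  \<^theory>\<open>HOL-Library.List_Lexorder\<close>, in which a proper prefix precedes its extensions.
\<close>

definition lyndon :: "'a::linorder list \<Rightarrow> bool" where
  "lyndon w \<longleftrightarrow> w \<noteq> [] \<and> (\<forall>v. strict_suffix v w \<and> v \<noteq> [] \<longrightarrow> w < v)"

text \<open>
  A factorization \<open>f\<^sub>1\<^bsup>e\<^sub>1\<^esup> \<dots> f\<^sub>m\<^bsup>e\<^sub>m\<^esup>\<close> is the list of the pairs \<open>(f\<^sub>i, e\<^sub>i)\<close>; its size is the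
  length of this list, so equal factors are counted once.
\<close>

definition lyndon_factorization :: "'a::linorder list \<Rightarrow> ('a list \<times> nat) list \<Rightarrow> bool" where
  "lyndon_factorization s fs \<longleftrightarrow>
     s = concat (map (\<lambda>(f, e). concat (replicate e f)) fs) \<and>
     (\<forall>(f, e) \<in> set fs. lyndon f \<and> 1 \<le> e) \<and>
     successively (\<lambda>f g. f > g) (map fst fs)"

text \<open>
  \<open>lz_phrase u r p\<close>: \<open>p\<close> is the phrase starting at the position that splits the string into the
  processed part \<open>u\<close> and the remaining part \<open>r\<close>. Occurrences in \<open>u\<close> do not overlap the phrase.
  Nonemptiness in the second case matters: if the first letter of \<open>r\<close> does not occur in \<open>u\<close>,
  the longest prefix of \<open>r\<close> occurring in \<open>u\<close> is empty and only the first case applies.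
\<close>

definition lz_phrase :: "'a list \<Rightarrow> 'a list \<Rightarrow> 'a list \<Rightarrow> bool" where
  "lz_phrase u r p \<longleftrightarrow> prefix p r \<and>
     ((\<exists>c. p = [c] \<and> c \<notin> set u) \<or>
      (p \<noteq> [] \<and> sublist p u \<and>
       (\<forall>q. prefix q r \<and> sublist q u \<longrightarrow> length q \<le> length p)))"

definition lz_factorization :: "'a list \<Rightarrow> 'a list list \<Rightarrow> bool" where
  "lz_factorization s ps \<longleftrightarrow>
     s = concat ps \<and>
     (\<forall>i < length ps. lz_phrase (concat (take i ps)) (concat (drop i ps)) (ps ! i))"

end

theory Submission
  imports Defs
begin

text \<open>
  Write \<open>w\<^sub>i = f\<^sub>i\<^bsup>e\<^sub>i\<^esup>\<close> for the runs. If \<open>w\<^sub>i \<dots> w\<^sub>j\<close> also occurs further left, starting in the run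
  \<open>l < i\<close>, then it is a proper prefix of each of \<open>f\<^sub>l, \<dots>, f\<^bsub>i-1\<^esub>\<close>. Let the domain of the run \<open>g\<close> be
  the runs \<open>l, \<dots>, g\<close>, where the leftmost occurrence of \<open>w\<^sub>g\<close> starts at \<open>w\<^sub>l\<close>. Domains are nested or
  disjoint, so the maximal ones partition the string, and it suffices that a domain of \<open>d\<close> runs
  contains at least \<open>(d + 1) / 2\<close> phrase ends.

  For induction this is strengthened: a domain of \<open>d\<close> runs that has \<open>c\<close> phrase ends in the leftmost
  occurrence of \<open>w\<^sub>g\<close> contains at least \<open>(d - 1) / 2 + c\<close> phrase ends. If \<open>w\<^sub>g\<close> contains a phrase
  end, split the remaining runs into maximal domains. Otherwise take the longest block
  \<open>w\<^sub>i \<dots> w\<^sub>g\<close> without phrase ends, which lies in one phrase. Each of its suffixes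
  \<open>w\<^sub>t \<dots> w\<^sub>g\<close> has its leftmost occurrence at the start of one of the maximal domains into which
  the runs \<open>l, \<dots>, i - 1\<close> split. Of those starting at the same place, each consists of two disjoint
  copies of the next shorter one with something after the first, and a phrase reaching from the
  leftmost copy to beyond the second would have copied the shorter suffix from further left.
  Hence every suffix of the block forces a new phrase end, which pays for the runs of the block.
\<close>

section \<open>Lexicographic order and suffixes of Lyndon words\<close>

lemma prefix_imp_le_list:
  fixes p q :: "'a::linorder list"
  assumes "prefix p q" shows "p \<le> q"
proof -
  have "p \<le> p @ r" for r by (induction p) auto
  then show ?thesis using assms by (auto simp: prefix_def)
qed

lemma append_le_append_iff:
  fixes p :: "'a::linorder list"
  shows "p @ a \<le> p @ b \<longleftrightarrow> a \<le> b"
  by (induction p) auto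

lemma prefix_of_le_between:
  fixes p q :: "'a::linorder list"
  assumes "p \<le> q" "q \<le> p @ r" shows "prefix p q"
  using assms
proof (induction p arbitrary: q)
  case (Cons a p)
  then show ?case by (cases q) auto
qed simp

lemma lyndon_le_suffix:
  assumes "lyndon f" "suffix y f" "y \<noteq> []"
  shows "f \<le> y"
  using assms unfolding lyndon_def by (cases "y = f") (auto simp: strict_suffix_def)

text \<open>The factors are peeled off one at a time: \<open>g < f \<le> y\<close> and
  \<open>y \<le> g @ ...\<close> force \<open>g\<close> to be a proper prefix of \<open>y\<close>,
  and what remains of \<open>y\<close> is again a nonempty suffix of \<open>f\<close>.\<close>

lemma lyndon_strict_prefix_suffix:
  assumes "lyndon f" "suffix y f" "y \<noteq> []" "\<forall>g \<in> set gs. g < f" "y \<le> concat gs @ z"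
  shows "strict_prefix (concat gs) y"
  using assms
proof (induction gs arbitrary: y)
  case (Cons g gs)
  have "g < y" using Cons.prems lyndon_le_suffix[of f y] by auto
  then have "prefix g y" using Cons.prems by (auto intro: prefix_of_le_between)
  then obtain y' where y': "y = g @ y'" by (auto simp: prefix_def)
  then have "y' \<noteq> []" using \<open>g < y\<close> by auto
  moreover have "suffix y' f" using Cons.prems(2) y' by (meson suffix_append suffix_order.trans suffixI)
  moreover have "y' \<le> concat gs @ z" using Cons.prems(5) y' by (simp add: append_le_append_iff)
  ultimately have "strict_prefix (concat gs) y'" using Cons by auto
  then show ?case using y' by (auto simp: strict_prefix_def)
qed (simp add: strict_prefix_def)

lemma drop_concat_replicate:
  assumes "k < length (concat (replicate e f))"
  shows "\<exists>y. suffix y f \<and> y \<noteq> [] \<and> prefix y (drop k (concat (replicate e f)))"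
  using assms
proof (induction e arbitrary: k)
  case (Suc e)
  show ?case
  proof (cases "k < length f")
    case True
    then show ?thesis by (intro exI[of _ "drop k f"]) (auto simp: suffix_drop)
  next
    case False
    then show ?thesis using Suc.IH[of "k - length f"] Suc.prems by auto
  qed
qed simp

lemma ex_interval_of_bounds:
  fixes p :: "nat \<Rightarrow> nat"
  assumes "p 0 \<le> x" "x < p n"
  shows "\<exists>k<n. p k \<le> x \<and> x < p (Suc k)"
  using assms
proof (induction n)
  case (Suc n)
  show ?case
  proof (cases "x < p n")
    case True
    then show ?thesis using Suc by (meson less_SucI)
  next
    case False
    then show ?thesis using Suc by (intro exI[of _ n]) auto
  qed
qed simp

section \<open>Runs, their positions, and occurrences\<close>

locale lyndon_lz =
  fixes s :: "'a::linorder list" and fs :: "('a list \<times> nat) list" and ps :: "'a list list"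
  assumes lyndon_fact: "lyndon_factorization s fs"
    and lz_fact: "lz_factorization s ps"
begin

definition m :: nat where "m = length fs"
definition f :: "nat \<Rightarrow> 'a list" where "f i = fst (fs ! i)"
definition run :: "nat \<Rightarrow> 'a list" where "run i = concat (replicate (snd (fs ! i)) (f i))"
definition runs :: "nat \<Rightarrow> nat \<Rightarrow> 'a list" where "runs i j = concat (map run [i..<j])"
definition start :: "nat \<Rightarrow> nat" where "start i = length (runs 0 i)"
definition occ :: "'a list \<Rightarrow> nat \<Rightarrow> bool" where "occ q j \<longleftrightarrow> prefix q (drop j s)"

text \<open>An end is the position just after the last letter of a phrase, so \<open>cnt a b\<close>
  counts the phrases whose last letter has an index in \<open>{a..<b}\<close>.\<close>

definition ends :: "nat set" where
  "ends = (\<lambda>k. length (concat (take (Suc k) ps))) ` {..<length ps}"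
definition cnt :: "nat \<Rightarrow> nat \<Rightarrow> nat" where "cnt a b = card (ends \<inter> {a<..b})"

lemma lyndon_f: "i < m \<Longrightarrow> lyndon (f i)"
  using lyndon_fact unfolding lyndon_factorization_def m_def f_def
  by (metis (no_types, lifting) case_prodD nth_mem prod.collapse)

lemma f_decreasing: assumes "i < j" "j < m" shows "f j < f i"
proof -
  have "successively (\<lambda>f g. f > g) (map fst fs)"
    using lyndon_fact by (simp add: lyndon_factorization_def)
  then have "sorted_wrt (\<lambda>f g. f > g) (map fst fs)"
    by (subst (asm) successively_conv_sorted_wrt) (auto intro!: transpI)
  then show ?thesis using assms sorted_wrt_nth_less[of _ "map fst fs" i j]
    by (simp add: f_def m_def)
qed

lemma f_antimono: "i \<le> j \<Longrightarrow> j < m \<Longrightarrow> f j \<le> f i"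
  using f_decreasing by (cases "i = j") (auto intro: less_imp_le)

lemma prefix_f_run: assumes "i < m" shows "prefix (f i) (run i)"
proof -
  have "1 \<le> snd (fs ! i)"
    using lyndon_fact assms unfolding lyndon_factorization_def m_def
    by (metis (no_types, lifting) case_prodD nth_mem prod.collapse)
  then show ?thesis unfolding run_def by (cases "snd (fs ! i)") auto
qed

lemma run_nonempty: "i < m \<Longrightarrow> run i \<noteq> []"
  using prefix_f_run[of i] lyndon_f[of i] by (auto simp: lyndon_def)

lemma runs_split: "i \<le> j \<Longrightarrow> j \<le> k \<Longrightarrow> runs i k = runs i j @ runs j k"
  using upt_add_eq_append[of i j "k - j"] by (simp add: runs_def)

lemma runs_Suc [simp]: "runs i (Suc i) = run i"
  by (simp add: runs_def)

lemma runs_nonempty: "i < j \<Longrightarrow> j \<le> m \<Longrightarrow> runs i j \<noteq> []"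
  using run_nonempty[of i] runs_split[of i "Suc i" j] by simp

lemma s_eq: "s = runs 0 m"
proof -
  have "map run [0..<m] = map (\<lambda>(f, e). concat (replicate e f)) fs"
    by (rule nth_equalityI) (auto simp: m_def run_def f_def case_prod_beta)
  then show ?thesis using lyndon_fact by (simp add: runs_def lyndon_factorization_def)
qed

lemma start_0 [simp]: "start 0 = 0"
  by (simp add: start_def runs_def)

lemma start_add: "i \<le> j \<Longrightarrow> start i + length (runs i j) = start j"
  using runs_split[of 0 i j] by (simp add: start_def)

lemma start_Suc: "start i + length (run i) = start (Suc i)"
  using start_add[of i "Suc i"] by simp

lemma start_mono: "i \<le> j \<Longrightarrow> start i \<le> start j"
  using start_add by fastforce

lemma start_less: "i < j \<Longrightarrow> j \<le> m \<Longrightarrow> start i < start j"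
  using start_add[of i j] runs_nonempty[of i j]
  by (metis less_add_same_cancel1 length_greater_0_conv less_imp_le)

lemma start_le_iff: "i \<le> m \<Longrightarrow> j \<le> m \<Longrightarrow> start i \<le> start j \<longleftrightarrow> i \<le> j"
  by (meson linorder_not_less start_less start_mono)

lemma drop_start: "i \<le> m \<Longrightarrow> drop (start i) s = runs i m"
  using runs_split[of 0 i m] by (simp add: start_def s_eq)

lemma occ_runs_start: "i \<le> j \<Longrightarrow> j \<le> m \<Longrightarrow> occ (runs i j) (start i)"
  by (simp add: occ_def drop_start runs_split[of i j m])

lemma occ_prefix: "occ q j \<Longrightarrow> prefix p q \<Longrightarrow> occ p j"
  unfolding occ_def by (rule prefix_order.trans)

lemma occ_append: "occ (p @ q) j \<Longrightarrow> occ q (j + length p)"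
  unfolding occ_def prefix_def by (metis add.commute append.assoc append_eq_conv_conj drop_drop)

lemma occ_length: "occ q j \<Longrightarrow> q \<noteq> [] \<Longrightarrow> j + length q \<le> length s"
  unfolding occ_def using prefix_length_le[of q "drop j s"]
  by (cases "j \<le> length s") auto

section \<open>Counting phrase ends, and the copies forced by their absence\<close>

lemma finite_ends [simp]: "finite ends"
  by (simp add: ends_def)

lemma cnt_split: "a \<le> b \<Longrightarrow> b \<le> c \<Longrightarrow> cnt a c = cnt a b + cnt b c"
  unfolding cnt_def by (subst card_Un_disjoint[symmetric]) (auto intro: arg_cong[where f = card])

lemma cnt_mono: "b \<le> c \<Longrightarrow> cnt a b \<le> cnt a c"
  unfolding cnt_def by (intro card_mono) auto

lemma cnt_eq_0_iff: "cnt a b = 0 \<longleftrightarrow> ends \<inter> {a<..b} = {}"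
  by (simp add: cnt_def)

lemma cnt_le_length: "cnt a b \<le> length ps"
proof -
  have "cnt a b \<le> card ends" unfolding cnt_def by (intro card_mono) auto
  also have "\<dots> \<le> length ps" unfolding ends_def using card_image_le[of "{..<length ps}"] by force
  finally show ?thesis .
qed

text \<open>A word that lies inside a single phrase, and does not end with it, has a copy that ends
  strictly before the phrase starts.\<close>

lemma copy_of_occ:
  assumes q: "q \<noteq> []" "occ q b" and "x \<le> b" and no_end: "cnt x (b + length q) = 0"
  shows "\<exists>c. occ q c \<and> c + length q < x"
proof -
  define pos where "pos k = length (concat (take k ps))" for k
  have s: "s = concat ps" using lz_fact by (simp add: lz_factorization_def)
  have "b + length q \<le> length s" using occ_length q by auto
  moreover have "length q > 0" using q by simp
  ultimately have "x < length s" using \<open>x \<le> b\<close> by linarith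
  then have "x < pos (length ps)" using s by (simp add: pos_def)
  then obtain k where k: "k < length ps" "pos k \<le> x" "x < pos (Suc k)"
    using ex_interval_of_bounds[of pos x "length ps"] by (auto simp: pos_def)
  define u where "u = concat (take k ps)"
  define p where "p = ps ! k"
  have "pos (Suc k) \<in> ends" using k by (auto simp: ends_def pos_def)
  then have end_gt: "b + length q < pos (Suc k)"
    using no_end k unfolding cnt_eq_0_iff by force
  have s2: "s = u @ p @ concat (drop (Suc k) ps)"
    using arg_cong[OF id_take_nth_drop[OF k(1)], of concat] by (simp add: s u_def p_def)
  have posk: "pos k = length u" by (simp add: pos_def u_def)
  have posS: "pos (Suc k) = length u + length p"
    using k by (simp add: pos_def u_def p_def take_Suc_conv_app_nth)
  have "lz_phrase u (concat (drop k ps)) p"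
    using lz_fact k by (simp add: lz_factorization_def u_def p_def)
  \<comment> \<open>This excludes a phrase that is a fresh letter. It rests on the strict inequality
    \<open>end_gt\<close>, which holds because \<open>cnt\<close> includes its right
    endpoint.\<close>
  moreover have "length p \<ge> 2"
    using end_gt posS posk k \<open>x \<le> b\<close> \<open>length q > 0\<close> by linarith
  ultimately have "sublist p u" by (auto simp: lz_phrase_def)
  then obtain a d where u: "u = a @ p @ d" by (auto simp: sublist_def)
  define i where "i = b - length u"
  have b: "b = length u + i" using \<open>x \<le> b\<close> k posk by (simp add: i_def)
  have "prefix q (drop b s)" using q by (simp add: occ_def)
  then have "prefix q (drop i p @ concat (drop (Suc k) ps))"
    using b posS end_gt by (simp add: s2)
  moreover have "length q \<le> length (drop i p)" using b posS end_gt by simp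
  ultimately have "prefix q (drop i p)"
    by (meson prefix_length_prefix prefixI)
  moreover have "drop (length a + i) s = drop i p @ d @ p @ concat (drop (Suc k) ps)"
    using b posS end_gt by (simp add: s2 u)
  ultimately have "occ q (length a + i)"
    unfolding occ_def by simp
  moreover have "length a + i + length q < x"
    using b posS end_gt u k posk by simp
  ultimately show ?thesis by blast
qed

section \<open>Leftmost occurrences and domains\<close>

text \<open>If \<open>y\<close> is the suffix of \<open>f l\<close> at which the occurrence starts, then
  \<open>f u \<le> f l \<le> y \<le> drop c s\<close>, and \<open>drop c s\<close> starts with factors that are all smaller than \<open>f u\<close>.\<close>

lemma earlier_occ_strict_prefix:
  assumes "i < j" "j \<le> m" "occ (runs i j) c" "start l \<le> c" "c < start (Suc l)" "l \<le> u" "u < i"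
  shows "strict_prefix (runs i j) (f u)"
proof -
  have um: "u < m" "l < m" using assms by auto
  have "drop c s = drop (c - start l) (run l @ runs (Suc l) m)"
    using assms um drop_start[of l] runs_split[of l "Suc l" m] drop_drop[of "c - start l" "start l" s]
    by simp
  moreover have "c - start l < length (run l)"
    using assms start_Suc[of l] by linarith
  ultimately have "prefix (drop (c - start l) (run l)) (drop c s)" by simp
  moreover obtain y where y: "suffix y (f l)" "y \<noteq> []" "prefix y (drop (c - start l) (run l))"
    using drop_concat_replicate[of "c - start l" "snd (fs ! l)" "f l"]
      \<open>c - start l < length (run l)\<close> unfolding run_def by auto
  ultimately have "y \<le> drop c s"
    using prefix_imp_le_list prefix_order.trans by blast
  moreover have "f u \<le> f l" using f_antimono assms um by simp
  moreover have "f l \<le> y" using lyndon_le_suffix lyndon_f um y by blast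
  moreover obtain z where z: "drop c s = runs i j @ z"
    using assms(3) by (auto simp: occ_def prefix_def)
  ultimately have le: "f u \<le> runs i j @ z" by simp
  \<comment> \<open>The runs are expanded into single Lyndon words, as
    \<open>lyndon_strict_prefix_suffix\<close> requires; it is then applied to \<open>f u\<close> as
    a suffix of itself.\<close>
  define gs where "gs = concat (map (\<lambda>k. replicate (snd (fs ! k)) (f k)) [i..<j])"
  have "concat (map run ks) = concat (concat (map (\<lambda>k. replicate (snd (fs ! k)) (f k)) ks))" for ks
    by (induction ks) (auto simp: run_def)
  then have "runs i j = concat gs" by (simp add: gs_def runs_def)
  moreover have "\<forall>g \<in> set gs. g < f u"
    using assms f_decreasing by (auto simp: gs_def)
  ultimately show ?thesis
    using lyndon_strict_prefix_suffix[of "f u" "f u" gs z] le lyndon_f[OF um(1)]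
    by (auto simp: lyndon_def)
qed

definition lo :: "nat \<Rightarrow> nat \<Rightarrow> nat" where
  "lo i j = (LEAST a. occ (runs i j) (start a))"

text \<open>The domain of the run \<open>g\<close> is the interval \<open>{dom g..g}\<close>.\<close>

definition dom :: "nat \<Rightarrow> nat" where "dom g = lo g (Suc g)"

text \<open>For \<open>a = dom g\<close> and \<open>q = run g\<close> this is the number
  \<open>c\<close> of the strengthened induction hypothesis.\<close>

definition lead :: "nat \<Rightarrow> 'a list \<Rightarrow> nat" where
  "lead a q = cnt (start a) (start a + length q)"

lemma occ_lo: "i \<le> j \<Longrightarrow> j \<le> m \<Longrightarrow> occ (runs i j) (start (lo i j))"
  unfolding lo_def by (rule LeastI[of _ i]) (rule occ_runs_start)

lemma lo_le: "i \<le> j \<Longrightarrow> j \<le> m \<Longrightarrow> lo i j \<le> i"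
  unfolding lo_def by (rule Least_le) (rule occ_runs_start)

lemma dom_le: "g < m \<Longrightarrow> dom g \<le> g"
  by (simp add: dom_def lo_le)

text \<open>Although \<open>lo\<close> minimizes over starts of runs only, nothing is lost: an
  occurrence starting in a run \<open>l < i\<close> makes the word a prefix of \<open>f l\<close>,
  so it also occurs at \<open>start l\<close>.\<close>

lemma start_lo_le:
  assumes "i < j" "j \<le> m" "occ (runs i j) c"
  shows "start (lo i j) \<le> c"
proof (cases "start i \<le> c")
  case True
  then show ?thesis using assms start_mono[of "lo i j" i] lo_le[of i j] by simp
next
  case False
  then obtain l where l: "l < i" "start l \<le> c" "c < start (Suc l)"
    using ex_interval_of_bounds[of start c i] by auto
  then have "prefix (runs i j) (f l)"
    using earlier_occ_strict_prefix[of i j c l l] assms by (simp add: strict_prefix_def)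
  then have "prefix (runs i j) (run l)"
    using prefix_f_run[of l] l assms by (auto intro: prefix_order.trans)
  moreover have "occ (run l) (start l)" using occ_runs_start[of l "Suc l"] l assms by simp
  ultimately have "lo i j \<le> l" unfolding lo_def by (intro Least_le) (rule occ_prefix)
  then show ?thesis using start_mono[of "lo i j" l] l by simp
qed

lemma strict_prefix_f_of_lo_le:
  assumes "i < j" "j \<le> m" "lo i j \<le> u" "u < i"
  shows "strict_prefix (runs i j) (f u)"
  using assms by (intro earlier_occ_strict_prefix[of i j "start (lo i j)" "lo i j"])
    (auto intro: occ_lo start_less)

lemma prefix_run_of_lo_le:
  assumes "i < j" "j \<le> m" "lo i j \<le> u" "u < i"
  shows "prefix (runs i j) (run u)"
  using strict_prefix_f_of_lo_le[OF assms] prefix_f_run[of u] assms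
  by (auto intro: prefix_order.trans simp: strict_prefix_def)

text \<open>Since \<open>run u\<close> begins with \<open>runs i j\<close>, the leftmost occurrence
  of \<open>run u\<close> contains an occurrence of \<open>runs i j\<close>. For single runs this
  makes domains nested or disjoint.\<close>

lemma lo_le_dom:
  assumes "i < j" "j \<le> m" "lo i j \<le> u" "u < i"
  shows "lo i j \<le> dom u"
proof -
  have "occ (run u) (start (dom u))" using occ_lo[of u "Suc u"] assms by (simp add: dom_def)
  then have "start (lo i j) \<le> start (dom u)"
    using prefix_run_of_lo_le[OF assms] occ_prefix start_lo_le assms by blast
  then show ?thesis using start_le_iff[of "lo i j" "dom u"] dom_le[of u] assms by simp
qed

lemma dom_mono: "dom g \<le> u \<Longrightarrow> u \<le> g \<Longrightarrow> g < m \<Longrightarrow> dom g \<le> dom u"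
  using lo_le_dom[of g "Suc g" u] by (cases "u = g") (auto simp: dom_def)

lemma lead_mono: "length p \<le> length q \<Longrightarrow> lead a p \<le> lead a q"
  by (simp add: lead_def cnt_mono)

section \<open>Phrase ends in leftmost occurrences\<close>

lemma leftmost_copy:
  assumes "i < j" "j \<le> m" "occ (runs i j) b" "x \<le> b" "cnt x (b + length (runs i j)) = 0"
  shows "start (lo i j) + length (runs i j) < x"
proof -
  obtain c where "occ (runs i j) c" "c + length (runs i j) < x"
    using copy_of_occ[of "runs i j" b x] runs_nonempty[of i j] assms by metis
  then show ?thesis using start_lo_le[of i j c] assms by simp
qed

lemma lead_lo_pos:
  assumes "i < j" "j \<le> m" shows "1 \<le> lead (lo i j) (runs i j)"
  using leftmost_copy[of i j "start (lo i j)" "start (lo i j)"] occ_lo[of i j] assms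
  by (auto simp: lead_def Suc_le_eq)

lemma lead_dom_pos: "g < m \<Longrightarrow> 1 \<le> lead (dom g) (run g)"
  using lead_lo_pos[of g "Suc g"] by (simp add: dom_def)

text \<open>A phrase that starts within the leftmost occurrence of a word cannot copy a later
  disjoint occurrence.\<close>

lemma lead_less_cnt:
  assumes "i < j" "j \<le> m" "occ (runs i j) b" "start (lo i j) + length (runs i j) \<le> b"
  shows "lead (lo i j) (runs i j) < cnt (start (lo i j)) (b + length (runs i j))"
proof -
  define x where "x = start (lo i j) + length (runs i j)"
  have "cnt x (b + length (runs i j)) \<noteq> 0"
    using leftmost_copy[of i j b x] assms by (auto simp: x_def)
  then show ?thesis
    using assms cnt_split[of "start (lo i j)" x "b + length (runs i j)"]
    by (simp add: lead_def x_def)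
qed

text \<open>\<open>runs (Suc t) h\<close> is a prefix of \<open>run t\<close>, so the leftmost
  occurrence of \<open>runs t h\<close> contains it at the front and again, disjointly, after
  \<open>run t\<close>. The second copy costs a further phrase end by
  \<open>lead_less_cnt\<close>.\<close>

lemma lead_Suc_less:
  assumes "Suc t < h" "h \<le> m" "lo (Suc t) h = lo t h"
  shows "lead (lo t h) (runs (Suc t) h) < lead (lo t h) (runs t h)"
proof -
  have eq: "runs t h = run t @ runs (Suc t) h"
    using runs_split[of t "Suc t" h] assms by simp
  have "occ (runs t h) (start (lo t h))" using assms by (intro occ_lo) auto
  then have "occ (runs (Suc t) h) (start (lo t h) + length (run t))"
    using eq occ_append by metis
  moreover have "length (runs (Suc t) h) \<le> length (run t)"
    using prefix_run_of_lo_le[of "Suc t" h t] lo_le[of t h] assms by (auto intro: prefix_length_le)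
  ultimately show ?thesis
    using lead_less_cnt[of "Suc t" h "start (lo t h) + length (run t)"] assms
    by (simp add: lead_def eq add.assoc)
qed

text \<open>The second conjunct, a surplus for runs that contain a phrase end, is needed when the run
  directly precedes a block without phrase ends.\<close>

definition dom_bound :: "nat \<Rightarrow> bool" where
  "dom_bound g \<longleftrightarrow>
     g - dom g + 2 * lead (dom g) (run g) \<le> 2 * cnt (start (dom g)) (start (Suc g)) \<and>
     (dom g < g \<longrightarrow> cnt (start g) (start (Suc g)) \<noteq> 0 \<longrightarrow>
       g - dom g + 2 * lead (dom g) (run g) < 2 * cnt (start (dom g)) (start (Suc g)))"

section \<open>Sums over maximal domains\<close>

text \<open>The domain of the last run is split off repeatedly. Each one contributes a strict
  inequality because its \<open>lead\<close> is at least 1.\<close>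

lemma closed_interval_bound:
  assumes "x < y" "y \<le> m" "\<forall>u. x \<le> u \<and> u < y \<longrightarrow> x \<le> dom u \<and> dom_bound u"
  shows "y - x < 2 * cnt (start x) (start y)"
  using assms
proof (induction y rule: less_induct)
  case (less y)
  define u where "u = y - 1"
  have u: "y = Suc u" "x \<le> u" "u < m" using less.prems by (auto simp: u_def)
  then have d: "x \<le> dom u" "dom u \<le> u" "dom_bound u" using less.prems dom_le by auto
  have last: "y - dom u < 2 * cnt (start (dom u)) (start y)"
    using d u lead_dom_pos[of u] by (auto simp: dom_bound_def)
  show ?case
  proof (cases "dom u = x")
    case False
    then have "dom u - x < 2 * cnt (start x) (start (dom u))"
      using less d u by (intro less.IH) auto
    then show ?thesis
      using last d u cnt_split[of "start x" "start (dom u)" "start y"] by (simp add: start_mono)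
  qed (use last in simp)
qed

text \<open>Only the first domain, which starts at \<open>dom g\<close>, pays for
  \<open>lead (dom g) (run g)\<close>: its last run begins with \<open>run g\<close>. The others pay
  for their own runs.\<close>

lemma domain_prefix_bound:
  assumes "g < m" "dom g < y" "y \<le> g" "\<forall>u. dom g \<le> u \<and> u < y \<longrightarrow> dom g \<le> dom u \<and> dom_bound u"
  shows "y - dom g + 2 * lead (dom g) (run g) \<le> 2 * cnt (start (dom g)) (start y) + 1"
  using assms(2-)
proof (induction y rule: less_induct)
  case (less y)
  define u where "u = y - 1"
  have u: "y = Suc u" "dom g \<le> u" "u < g" "u < m" using less.prems assms by (auto simp: u_def)
  define a where "a = dom u"
  have a: "dom g \<le> a" "a \<le> u" "dom_bound u" using less.prems dom_le u by (auto simp: a_def)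
  have "prefix (run g) (run u)"
    using prefix_run_of_lo_le[of g "Suc g" u] u assms(1) by (simp add: dom_def)
  then have lead: "lead a (run g) \<le> lead a (run u)" by (intro lead_mono prefix_length_le)
  have last: "u - a + 2 * lead a (run u) \<le> 2 * cnt (start a) (start y)"
    using a u by (simp add: dom_bound_def a_def)
  show ?case
  proof (cases "a = dom g")
    case True
    then show ?thesis using last lead u by simp
  next
    case False
    then have "a - dom g + 2 * lead (dom g) (run g) \<le> 2 * cnt (start (dom g)) (start a) + 1"
      using less a u by (intro less.IH) auto
    moreover have "cnt (start (dom g)) (start y) = cnt (start (dom g)) (start a) + cnt (start a) (start y)"
      using a u by (intro cnt_split) (auto intro: start_mono)
    moreover have "1 \<le> lead a (run u)" using lead_dom_pos u by (simp add: a_def)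
    ultimately show ?thesis using last a u by simp
  qed
qed

section \<open>Blocks of runs without phrase ends\<close>

context
  fixes i h :: nat
  assumes block: "0 < i" "i < h" "h \<le> m" "cnt (start i) (start h) = 0"
begin

text \<open>A charging scheme: each suffix of the block is charged to the run where its leftmost
  occurrence starts.\<close>

definition levels :: "nat \<Rightarrow> nat" where "levels a = card {t \<in> {i..<h}. lo t h = a}"

lemma block_lo_less: assumes "i \<le> t" "t < h" shows "lo t h < t"
proof -
  have "cnt (start t) (start t + length (runs t h)) = 0"
    using assms block start_add[of t h] start_mono[of i t] start_mono[of t h]
      cnt_split[of "start i" "start t" "start h"] by simp
  then have "start (lo t h) < start t"
    using leftmost_copy[of t h "start t" "start t"] occ_runs_start[of t h] assms block by simp
  then show ?thesis using start_mono[of t "lo t h"] by (meson leD leI)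
qed

text \<open>With \<open>a = lo n h\<close>, the whole of \<open>runs n h\<close> fits into
  \<open>run a\<close>, so the shorter suffix occurs strictly before \<open>start (Suc a)\<close>.
  As \<open>lo\<close> is a run index, it cannot exceed \<open>a\<close>.\<close>

lemma block_lo_antimono: assumes "i \<le> t" "t \<le> t'" "t' < h" shows "lo t' h \<le> lo t h"
  using assms(2,3)
proof (induction rule: dec_induct)
  case (step n)
  define a where "a = lo n h"
  have a: "a < n" using block_lo_less[of n] step assms by (simp add: a_def)
  have eq: "runs n h = run n @ runs (Suc n) h"
    using runs_split[of n "Suc n" h] step by simp
  have "occ (runs n h) (start a)" unfolding a_def using step block by (intro occ_lo) auto
  then have "start (lo (Suc n) h) \<le> start a + length (run n)"
    using eq occ_append start_lo_le[of "Suc n" h] step block by metis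
  also have "length (runs n h) \<le> length (run a)"
    using prefix_run_of_lo_le[of n h a] a step block by (auto simp: a_def intro: prefix_length_le)
  then have "start a + length (run n) < start (Suc a)"
    using start_Suc[of a] runs_nonempty[of "Suc n" h] step block eq
    by (cases "runs (Suc n) h") auto
  finally have "lo (Suc n) h \<le> a" using start_mono[of "Suc a" "lo (Suc n) h"]
    by (meson leD leI not_less_eq_eq)
  then show ?case using step by (simp add: a_def)
qed simp

lemma block_lo_less_i: "i \<le> t \<Longrightarrow> t < h \<Longrightarrow> lo t h < i"
  using block_lo_antimono[of i t] block_lo_less[of i] block by simp

text \<open>Among suffixes charged to the same run, each longer one gains a phrase end by
  \<open>lead_Suc_less\<close>. At \<open>dom (h - 1)\<close> the shortest is
  \<open>run (h - 1)\<close> itself, so the count starts from its \<open>lead\<close> instead of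
  from 1.\<close>

lemma card_levels_le_lead:
  assumes "i \<le> t" "t < h"
  shows "card {t' \<in> {t..<h}. lo t' h = lo t h} \<le> lead (lo t h) (runs t h) \<and>
    (lo t h = dom (h - 1) \<longrightarrow>
      card {t' \<in> {t..<h}. lo t' h = lo t h} + lead (lo t h) (run (h - 1))
        \<le> lead (lo t h) (runs t h) + 1)"
  using assms
proof (induction "h - t" arbitrary: t)
  case (Suc k)
  have dom_last: "dom (h - 1) = lo (h - 1) h" using Suc.prems by (simp add: dom_def)
  show ?case
  proof (cases "Suc t < h \<and> lo (Suc t) h = lo t h")
    case True
    have "{t' \<in> {t..<h}. lo t' h = lo t h} = insert t {t' \<in> {Suc t..<h}. lo t' h = lo t h}"
      using Suc.prems by (auto simp: le_Suc_eq Suc_le_eq)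
    then have "card {t' \<in> {t..<h}. lo t' h = lo t h}
        = Suc (card {t' \<in> {Suc t..<h}. lo t' h = lo t h})" by simp
    moreover have "lead (lo t h) (runs (Suc t) h) < lead (lo t h) (runs t h)"
      using lead_Suc_less[of t h] True block by simp
    moreover have "k = h - Suc t" using Suc.hyps(2) by simp
    then have "card {t' \<in> {Suc t..<h}. lo t' h = lo t h} \<le> lead (lo t h) (runs (Suc t) h) \<and>
      (lo t h = dom (h - 1) \<longrightarrow>
        card {t' \<in> {Suc t..<h}. lo t' h = lo t h} + lead (lo t h) (run (h - 1))
          \<le> lead (lo t h) (runs (Suc t) h) + 1)"
      using Suc.hyps(1)[of "Suc t"] Suc.prems True by simp
    ultimately show ?thesis by linarith
  next
    case False
    \<comment> \<open>By antimonotonicity the suffixes charged to one run are consecutive, so here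
      \<open>t\<close> is the last of them.\<close>
    then have neq: "lo t' h \<noteq> lo t h" if "Suc t \<le> t'" "t' < h" for t'
      using block_lo_antimono[of "Suc t" t'] block_lo_antimono[of t "Suc t"] that Suc.prems by force
    have "t' \<in> {t}" if "t' \<in> {t..<h}" "lo t' h = lo t h" for t'
      using neq[of t'] that by (cases "t' = t") auto
    moreover have "t \<in> {t..<h}" using Suc.prems by simp
    ultimately have "{t' \<in> {t..<h}. lo t' h = lo t h} = {t}" by blast
    then have card: "card {t' \<in> {t..<h}. lo t' h = lo t h} = 1" by simp
    have last: "t = h - 1" if "lo t h = dom (h - 1)"
    proof (rule ccontr)
      assume "t \<noteq> h - 1"
      then have "Suc t \<le> h - 1" "h - 1 < h" using Suc.prems by auto
      then show False using neq[of "h - 1"] that dom_last by simp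
    qed
    have "runs (h - 1) h = run (h - 1)"
      using runs_Suc[of "h - 1"] Suc.prems by simp
    then have "runs t h = run (h - 1)" if "lo t h = dom (h - 1)"
      using last[OF that] by metis
    moreover have "1 \<le> lead (lo t h) (runs t h)"
      using lead_lo_pos Suc.prems block by simp
    ultimately show ?thesis unfolding card by simp
  qed
qed simp

text \<open>The longest suffix charged to \<open>a\<close> is a prefix of \<open>run y\<close>. The
  choice \<open>q = runs i h\<close> serves the case of a single-run domain directly before the
  block.\<close>

lemma levels_le_lead:
  assumes "y < i" "dom y = a" "levels a \<noteq> 0" "length (runs i h) \<le> length q \<or> q = run y"
  shows "levels a \<le> lead a q \<and>
    (a = dom (h - 1) \<longrightarrow> levels a + lead a (run (h - 1)) \<le> lead a q + 1)"
proof -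
  define t where "t = (LEAST t. i \<le> t \<and> t < h \<and> lo t h = a)"
  have "{t \<in> {i..<h}. lo t h = a} \<noteq> {}" using assms by (auto simp: levels_def)
  then have "\<exists>t. i \<le> t \<and> t < h \<and> lo t h = a" by auto
  then have t: "i \<le> t \<and> t < h \<and> lo t h = a" unfolding t_def by (rule LeastI_ex)
  have "t \<le> t'" if "i \<le> t'" "t' < h" "lo t' h = a" for t'
    unfolding t_def using that by (intro Least_le) auto
  then have "{t' \<in> {i..<h}. lo t' h = a} = {t' \<in> {t..<h}. lo t' h = a}"
    using t by (auto intro: order.trans)
  then have lev: "levels a = card {t' \<in> {t..<h}. lo t' h = a}" by (simp add: levels_def)
  have "lo t h \<le> y" using t assms dom_le[of y] block by simp
  then have "prefix (runs t h) (run y)"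
    using prefix_run_of_lo_le[of t h y] t assms block by simp
  moreover have "length (runs t h) \<le> length (runs i h)"
    using runs_split[of i t h] t by simp
  ultimately have "length (runs t h) \<le> length q"
    using assms by (auto dest: prefix_length_le)
  then have "lead a (runs t h) \<le> lead a q" by (rule lead_mono)
  then show ?thesis using card_levels_le_lead[of t] t lev by auto
qed

lemma last_levels_pos: "levels (dom (h - 1)) \<noteq> 0"
proof -
  have "h - 1 \<in> {t \<in> {i..<h}. lo t h = dom (h - 1)}" using block by (auto simp: dom_def)
  then show ?thesis unfolding levels_def by (auto simp: card_eq_0_iff)
qed

text \<open>The domain directly before the block must yield one unit more than the other domains. If
  it has several runs, this is the surplus in \<open>dom_bound\<close>; if it is a single run, the
  extra end comes from the block itself.\<close>

lemma last_domain_bound: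
  assumes "dom_bound (i - 1)" "cnt (start (i - 1)) (start i) \<noteq> 0" "a = dom (i - 1)"
  shows "i - a + levels a < 2 * cnt (start a) (start i)"
    and "a = dom (h - 1) \<Longrightarrow>
      i - a + 2 * (levels a + lead a (run (h - 1))) \<le> 2 * cnt (start a) (start i) + 2"
proof -
  obtain j where j: "i = Suc j" using block by (cases i) auto
  have a: "a = dom j" "a \<le> j" "j < m" using assms j dom_le[of j] block by auto
  define r where "r = lead a (run j)"
  have r: "1 \<le> r" using a lead_dom_pos[of j] by (simp add: r_def)
  have lv: "levels a \<le> r \<and> (a = dom (h - 1) \<longrightarrow> levels a + lead a (run (h - 1)) \<le> r + 1)"
    if "levels a \<noteq> 0"
    using levels_le_lead[of j a "run j"] that a j by (simp add: r_def)
  have lv1: "levels a \<le> r" using lv by (cases "levels a = 0") auto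
  have lv2: "a = dom (h - 1) \<longrightarrow> levels a + lead a (run (h - 1)) \<le> r + 1"
    using lv last_levels_pos by auto
  have "(i - a + levels a < 2 * cnt (start a) (start i)) \<and> (a = dom (h - 1) \<longrightarrow>
      i - a + 2 * (levels a + lead a (run (h - 1))) \<le> 2 * cnt (start a) (start i) + 2)"
  proof (cases "a < j")
    case True
    then have "j - a + 2 * r < 2 * cnt (start a) (start i)"
      using assms a j by (simp add: dom_bound_def r_def)
    moreover have "i - a = Suc (j - a)" using j True by simp
    ultimately have "i - a + 2 * r \<le> 2 * cnt (start a) (start i)" by linarith
    then have "i - a + levels a < 2 * cnt (start a) (start i)" using lv1 r by linarith
    moreover have "i - a + 2 * (levels a + lead a (run (h - 1))) \<le> 2 * cnt (start a) (start i) + 2"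
      if "a = dom (h - 1)"
    proof -
      have "levels a + lead a (run (h - 1)) \<le> r + 1" using lv2 that by blast
      then have "2 * (levels a + lead a (run (h - 1))) \<le> 2 * r + 2" by simp
      then show ?thesis using \<open>i - a + 2 * r \<le> 2 * cnt (start a) (start i)\<close> by linarith
    qed
    ultimately show ?thesis by blast
  next
    case False
    then have aj: "a = j" using a by simp
    then have cnt_r: "cnt (start a) (start i) = r"
      using start_Suc[of j] j by (simp add: r_def lead_def)
    show ?thesis
    proof (cases "levels a = 0")
      case True
      then show ?thesis using last_levels_pos cnt_r r j aj by auto
    next
      case False
      then obtain t where t: "i \<le> t" "t < h" "lo t h = a"
        unfolding levels_def by (auto simp: card_eq_0_iff)
      then have loi: "lo i h = a"
        using block_lo_antimono[of i t] block_lo_less[of i] block j aj by simp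
      have len: "length (runs i h) \<le> length (run j)"
        using prefix_run_of_lo_le[of i h j] loi aj j block by (auto intro: prefix_length_le)
      \<comment> \<open>The block at \<open>start i\<close> is disjoint from its leftmost
        occurrence, so a further end is needed; the block contains none, hence it lies in
        \<open>run j\<close>.\<close>
      have "lead a (runs i h) < cnt (start a) (start i + length (runs i h))"
        using lead_less_cnt[of i h "start i"] loi len aj j block start_Suc[of j]
        by (simp add: occ_runs_start)
      then have "lead a (runs i h) < cnt (start a) (start i)"
        using cnt_split[of "start a" "start i" "start h"] start_add[of i h] block aj j
        by (simp add: start_mono)
      moreover have "levels a \<le> lead a (runs i h) \<and>
          (a = dom (h - 1) \<longrightarrow> levels a + lead a (run (h - 1)) \<le> lead a (runs i h) + 1)"
        using levels_le_lead[of j a "runs i h"] False a j by simp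
      ultimately show ?thesis using j aj by auto
    qed
  qed
  then show "i - a + levels a < 2 * cnt (start a) (start i)"
    and "a = dom (h - 1) \<Longrightarrow>
      i - a + 2 * (levels a + lead a (run (h - 1))) \<le> 2 * cnt (start a) (start i) + 2" by auto
qed

text \<open>By \<open>lo_le_dom\<close> a charge never lands in the interior of a domain, only at
  its first run.\<close>

lemma lo_eq_dom:
  assumes "y < i" "i \<le> t" "t < h" "dom y \<le> lo t h" "lo t h \<le> y"
  shows "lo t h = dom y"
  using lo_le_dom[of t h y] assms block by simp

lemma levels_between:
  assumes "y < i" "x \<le> dom y"
  shows "card {t \<in> {i..<h}. x \<le> lo t h \<and> lo t h \<le> y}
    = card {t \<in> {i..<h}. x \<le> lo t h \<and> lo t h < dom y} + levels (dom y)"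
proof -
  have "lo t h \<le> y \<longleftrightarrow> lo t h < dom y \<or> lo t h = dom y" if "i \<le> t" "t < h" for t
    using lo_eq_dom[of y t] dom_le[of y] that assms block by force
  then have "{t \<in> {i..<h}. x \<le> lo t h \<and> lo t h \<le> y}
    = {t \<in> {i..<h}. x \<le> lo t h \<and> lo t h < dom y} \<union> {t \<in> {i..<h}. lo t h = dom y}"
    using assms by auto
  then show ?thesis unfolding levels_def
    by (simp add: card_Un_disjoint disjoint_iff)
qed

text \<open>The \<open>lead\<close> of each domain absorbs its charges. The first domain also pays
  for \<open>lead x (run (h - 1))\<close>, where the last suffix of the block guarantees a
  charge.\<close>

lemma initial_domains_bound:
  assumes "x = dom (h - 1)" "x < y" "y \<le> i" "\<forall>u. x \<le> u \<and> u < y \<longrightarrow> x \<le> dom u \<and> dom_bound u"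
  shows "y - x + card {t \<in> {i..<h}. x \<le> lo t h \<and> lo t h < y} + 2 * lead x (run (h - 1))
    \<le> 2 * cnt (start x) (start y) + 2"
  using assms(2-)
proof (induction y rule: less_induct)
  case (less y)
  define u where "u = y - 1"
  have u: "y = Suc u" "x \<le> u" "u < i" "u < m" using less.prems block by (auto simp: u_def)
  define a where "a = dom u"
  have a: "x \<le> a" "a \<le> u" "dom_bound u" using less.prems dom_le u by (auto simp: a_def)
  have last: "u - a + 2 * lead a (run u) \<le> 2 * cnt (start a) (start y)"
    using a u by (simp add: dom_bound_def a_def)
  have lead: "1 \<le> lead a (run u)" using lead_dom_pos u by (simp add: a_def)
  have lev: "levels a \<noteq> 0 \<Longrightarrow> levels a \<le> lead a (run u) \<and>
      (a = x \<longrightarrow> levels a + lead a (run (h - 1)) \<le> lead a (run u) + 1)"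
    using levels_le_lead[of u a "run u"] u a_def assms(1) by simp
  have between: "card {t \<in> {i..<h}. x \<le> lo t h \<and> lo t h < y}
      = card {t \<in> {i..<h}. x \<le> lo t h \<and> lo t h < a} + levels a"
    using levels_between[of u x] u a by (simp add: a_def less_Suc_eq_le)
  show ?case
  proof (cases "a = x")
    case True
    then have "{t \<in> {i..<h}. x \<le> lo t h \<and> lo t h < a} = {}" by auto
    then have "card {t \<in> {i..<h}. x \<le> lo t h \<and> lo t h < a} = 0" by (metis card.empty)
    moreover have "levels a + lead a (run (h - 1)) \<le> lead a (run u) + 1"
      using lev True last_levels_pos assms(1) by simp
    moreover have "1 \<le> levels a" using True last_levels_pos assms(1) by simp
    ultimately show ?thesis using last between u unfolding True[symmetric] by linarith
  next
    case False
    then have "a - x + card {t \<in> {i..<h}. x \<le> lo t h \<and> lo t h < a} + 2 * lead x (run (h - 1))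
        \<le> 2 * cnt (start x) (start a) + 2"
      using less a u by (intro less.IH) auto
    moreover have "cnt (start x) (start y) = cnt (start x) (start a) + cnt (start a) (start y)"
      using a u by (intro cnt_split) (auto intro: start_mono)
    moreover have "y - a + levels a \<le> 2 * cnt (start a) (start y)"
      using last lead lev a u by (cases "levels a = 0") auto
    ultimately show ?thesis using between a u by simp
  qed
qed

lemma block_dom_bound:
  assumes "h = Suc g" "dom g < i" "cnt (start (i - 1)) (start i) \<noteq> 0"
    and bound: "\<forall>u<g. dom_bound u"
  shows "dom_bound g"
proof -
  define x where "x = dom g"
  have closed: "\<forall>u. x \<le> u \<and> u < i \<longrightarrow> x \<le> dom u \<and> dom_bound u"
    using dom_mono[of g] bound assms block by (auto simp: x_def)
  define a where "a = dom (i - 1)"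
  have a: "x \<le> a" "a < i" using closed assms dom_le[of "i - 1"] block by (auto simp: x_def a_def less_eq_Suc_le)
  have strong: "i - a + levels a < 2 * cnt (start a) (start i)"
    "a = x \<Longrightarrow> i - a + 2 * (levels a + lead a (run g)) \<le> 2 * cnt (start a) (start i) + 2"
    using last_domain_bound[of a] bound assms block by (auto simp: x_def a_def)
  have "x \<le> lo t h" if "i \<le> t" "t < h" for t
    using block_lo_antimono[of t g] that assms by (simp add: x_def dom_def)
  then have "{t \<in> {i..<h}. x \<le> lo t h \<and> lo t h \<le> i - 1} = {i..<h}"
    using block_lo_less_i by fastforce
  then have total: "card {t \<in> {i..<h}. x \<le> lo t h \<and> lo t h < a} + levels a = h - i"
    using levels_between[of "i - 1" x] a block by (simp add: a_def)
  \<comment> \<open>The charges add up to \<open>h - i\<close>, which pays for the runs of the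
    block. When \<open>a\<close> differs from \<open>x\<close>, the strictness of
    \<open>strong(1)\<close> removes the last unit.\<close>
  have "g - x + 2 * lead x (run g) \<le> 2 * cnt (start x) (start i)"
  proof (cases "a = x")
    case True
    then have "{t \<in> {i..<h}. x \<le> lo t h \<and> lo t h < a} = {}" by auto
    then have "levels a = h - i" using total by (metis add_0 card.empty)
    then show ?thesis using strong True assms(1) a block by simp
  next
    case False
    then have "a - x + card {t \<in> {i..<h}. x \<le> lo t h \<and> lo t h < a} + 2 * lead x (run g)
        \<le> 2 * cnt (start x) (start a) + 2"
      using initial_domains_bound[of x a] closed a assms(1) by (simp add: x_def)
    moreover have "cnt (start x) (start i) = cnt (start x) (start a) + cnt (start a) (start i)"
      using a by (intro cnt_split) (auto intro: start_mono)
    ultimately show ?thesis using strong(1) total a assms(1) block by simp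
  qed
  moreover have "cnt (start x) (start i) \<le> cnt (start x) (start h)"
    using block by (intro cnt_mono start_mono) simp
  moreover have "cnt (start g) (start (Suc g)) = 0"
    using block assms(1) cnt_split[of "start i" "start g" "start h"] by (simp add: start_mono)
  ultimately show ?thesis using assms(1) by (simp add: dom_bound_def x_def)
qed

end

section \<open>The induction over runs and the conclusion\<close>

lemma dom_bound: "g < m \<Longrightarrow> dom_bound g"
proof (induction g rule: less_induct)
  case (less g)
  define x where "x = dom g"
  have x: "x \<le> g" using dom_le less.prems by (simp add: x_def)
  have IH: "\<forall>u<g. dom_bound u" using less by simp
  show ?case
  proof (cases "x = g")
    case True
    then show ?thesis using start_Suc[of g] by (simp add: dom_bound_def x_def lead_def)
  next
    case False
    then have "x < g" using x by simp
    show ?thesis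
    proof (cases "cnt (start g) (start (Suc g)) = 0")
      case True
      have len: "length (run g) \<le> length (run x)"
        using prefix_run_of_lo_le[of g "Suc g" x] \<open>x < g\<close> less.prems
        by (auto simp: x_def dom_def intro: prefix_length_le)
      have "1 \<le> cnt (start x) (start (Suc x))"
        using lead_dom_pos[OF less.prems] lead_mono[OF len, of x] start_Suc[of x]
        by (simp add: x_def lead_def)
      \<comment> \<open>The block starts after the last run before \<open>g\<close> that contains a
        phrase end. Such a run exists: \<open>run x\<close> begins with the leftmost occurrence of
        \<open>run g\<close>, which contains one.\<close>
      define P where "P j \<longleftrightarrow> j < g \<and> cnt (start j) (start (Suc j)) \<noteq> 0" for j
      have "P x" using \<open>x < g\<close> \<open>1 \<le> cnt (start x) (start (Suc x))\<close> by (simp add: P_def)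
      moreover have "\<forall>j. P j \<longrightarrow> j \<le> g" by (simp add: P_def)
      ultimately obtain j where j: "P j" "\<And>j'. P j' \<Longrightarrow> j' \<le> j" and "x \<le> j"
        by (metis GreatestI_nat Greatest_le_nat)
      have "cnt (start (Suc j)) (start k) = 0" if "Suc j \<le> k" "k \<le> Suc g" for k
        using that
      proof (induction rule: dec_induct)
        case (step n)
        have "cnt (start n) (start (Suc n)) = 0"
          using j(2)[of n] step True by (cases "n = g") (auto simp: P_def)
        then show ?case
          using step cnt_split[of "start (Suc j)" "start n" "start (Suc n)"] by (simp add: start_mono)
      qed (simp add: cnt_def)
      then have "cnt (start (Suc j)) (start (Suc g)) = 0" using j by (simp add: P_def)
      then show ?thesis
        using block_dom_bound[of "Suc j" "Suc g" g] j \<open>x \<le> j\<close> IH less.prems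
        by (simp add: P_def x_def)
    next
      case False
      have closed: "\<forall>v. x \<le> v \<and> v < g \<longrightarrow> x \<le> dom v \<and> dom_bound v"
        using dom_mono[of g] IH less.prems by (auto simp: x_def)
      \<comment> \<open>The phrase end in \<open>run g\<close> adds 2 on the right, which outweighs
        the \<open>+ 1\<close> and leaves the strict inequality.\<close>
      have "g - x + 2 * lead x (run g) \<le> 2 * cnt (start x) (start g) + 1"
        using domain_prefix_bound[of g g] closed \<open>x < g\<close> less.prems by (simp add: x_def)
      then show ?thesis
        using False cnt_split[of "start x" "start g" "start (Suc g)"] \<open>x < g\<close>
        by (simp add: dom_bound_def x_def start_mono)
    qed
  qed
qed

lemma length_fs_less:
  assumes "s \<noteq> []" shows "length fs < 2 * length ps"
proof -
  have "m \<noteq> 0" using assms s_eq by (auto simp: runs_def)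
  then have "m - 0 < 2 * cnt (start 0) (start m)"
    using dom_bound by (intro closed_interval_bound) auto
  then show ?thesis using cnt_le_length[of "start 0" "start m"] by (simp add: m_def)
qed

end

theorem theorem1:
  fixes s :: "'a::linorder list"
    and fs :: "('a list \<times> nat) list"
    and ps :: "'a list list"
  assumes "s \<noteq> []"
    and "lyndon_factorization s fs"
    and "lz_factorization s ps"
  shows "length fs < 2 * length ps"
proof -
  interpret lyndon_lz s fs ps using assms by unfold_locales
  show ?thesis using assms(1) by (rule length_fs_less)
qed

end
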